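(* Let $p,q$ be distinct odd primes with $n=pq$ equal to $3p$ (i.e. $q=3$), or $n=35$, or $n=55$. Then $$\{p^3m : m\in\mathbb Z,\ \gcd(m,q)=1\}\cup\{q^3m : m\in\mathbb Z,\ \gcd(m,p)=1\}\subseteq S_{pq}.$$
   Context: For a positive integer $n$, $S_n$ denotes the set of all $n\times n$ circulant determinants with integer entries, i.e. $S_n=\{\det(a_{(j-i)\bmod n})_{0\le i,j\le n-1} : (a_0,\dots,a_{n-1})\in\mathbb Z^n\}$. Equivalently $S_n=\{M_n(F): F\in\mathbb Z[x]\}$, where $M_n(F)=\prod_{j=1}^n F(\omega_n^j)$ and $\omega_n=e^{2\pi i/n}$. *)

theory Defs
  imports "Jordan_Normal_Form.Determinant" "HOL-Computational_Algebra.Primes"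
begin

text \<open>Indices run over \<open>0..n-1\<close>. The difference \<open>j - i\<close> is reduced modulo \<open>n\<close> over the
  integers, since subtraction on \<^typ>\<open>nat\<close> truncates.\<close>

definition circulant_mat :: "nat \<Rightarrow> int vec \<Rightarrow> int mat" where
  "circulant_mat n a = mat n n (\<lambda>(i, j). a $ nat ((int j - int i) mod int n))"

definition circulant_dets :: "nat \<Rightarrow> int set" where
  "circulant_dets n = {det (circulant_mat n a) | a. a \<in> carrier_vec n}"

end

theory Submission
  imports Defs "Jordan_Normal_Form.Char_Poly" "HOL-Number_Theory.Cong" Complex_Main
begin

text \<open>
  A circulant determinant of size \<open>n = pq\<close> is the product of \<open>F(1)\<close> and the norms of \<open>F\<close> at the primitive
  roots of unity of orders \<open>p\<close>, \<open>q\<close> and \<open>pq\<close>. It suffices to find one \<open>F\<close> with \<open>F(1) = p t\<close>, \<open>q\<close> not dividing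
  \<open>t\<close>, and norms \<open>p\<^sup>2\<close>, \<open>1\<close>, \<open>1\<close>: multiplying by \<open>(x\<^sup>a - 1)/(x - 1)\<close> with \<open>a\<close> prime to \<open>n\<close> and adding multiples of
  \<open>(x\<^sup>n - 1)/(x - 1)\<close> changes only \<open>F(1)\<close>, which then takes every value \<open>p m\<close> with \<open>m\<close> prime to \<open>q\<close>.

  Such an \<open>F\<close> is obtained by gluing \<open>(1 - x)\<^sup>2\<close> times units at the roots of order \<open>p\<close> and \<open>pq\<close> to a unit at
  the roots of order \<open>q\<close>. This is possible when an integer multiple of \<open>(1 - x)\<^sup>2\<close> is congruent modulo \<open>p\<close> to a
  unit of the \<open>q\<close>-th cyclotomic field. For \<open>q = 3\<close> this holds because \<open>(1 - x)\<^sup>2 = -3x\<close>; for \<open>n = 35\<close> and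
  \<open>n = 55\<close> explicit cyclotomic units do it. The multiples of \<open>27\<close> come from \<open>F = 1 + x\<^sup>3 + x\<^sup>6\<close>.
\<close>

section \<open>Circulant determinants as products over roots of unity\<close>

definition omega :: "nat \<Rightarrow> complex" where
  "omega n = cis (2 * pi / real n)"

lemma omega_power_eq_1_iff:
  assumes "n > 0"
  shows "omega n ^ j = 1 \<longleftrightarrow> n dvd j"
proof
  assume "omega n ^ j = 1"
  then have "cos (real j * (2 * pi / real n)) = 1"
    by (simp add: omega_def DeMoivre complex_eq_iff)
  then obtain x :: int where "real j * (2 * pi / real n) = of_int x * 2 * pi"
    using cos_one_2pi_int by auto
  then have "real j = of_int x * real n"
    using assms by (simp add: field_simps)
  then have "int j = x * int n"
    by (metis of_int_eq_iff of_int_mult of_int_of_nat_eq)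
  then show "n dvd j"
    by (metis dvd_triv_right int_dvd_int_iff)
next
  assume "n dvd j"
  then obtain k where "j = n * k" ..
  moreover have "omega n ^ n = 1"
    using assms by (simp add: omega_def DeMoivre)
  ultimately show "omega n ^ j = 1"
    by (simp add: power_mult)
qed

lemma omega_neq_0 [simp]: "omega n \<noteq> 0"
  by (simp add: omega_def)

lemma omega_power_mod:
  assumes "n > 0"
  shows "omega n ^ (j mod n) = omega n ^ j"
proof -
  have "omega n ^ j = omega n ^ (n * (j div n) + j mod n)"
    by simp
  also have "\<dots> = omega n ^ (j mod n)"
    using omega_power_eq_1_iff[OF assms, of "n * (j div n)"] by (simp only: power_add) simp
  finally show ?thesis ..
qed

lemma omega_power_power_self [simp]: "(omega n ^ l) ^ n = 1"
  by (cases "n = 0") (simp_all add: omega_power_eq_1_iff flip: power_mult)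

lemma sum_powers_root_of_unity:
  fixes z :: "'a :: field"
  assumes "z ^ n = 1" and "z \<noteq> 1"
  shows "(\<Sum>i<n. z ^ i) = 0"
  using assms by (simp add: geometric_sum)

text \<open>The columns of the Fourier matrix \<open>V\<close> are eigenvectors of the circulant,
  with eigenvalues \<open>ev l\<close>. The product of \<open>V\<close> with its conjugate
  \<open>W\<close> is \<open>n\<close> times the identity, so \<open>det V\<close> can be
  cancelled.\<close>

lemma det_circulant_mat:
  assumes n: "n > 0"
  shows "of_int (det (circulant_mat n a)) = (\<Prod>l<n. \<Sum>k<n. of_int (a $ k) * (omega n ^ l) ^ k)"
proof -
  define ev where "ev l = (\<Sum>k<n. of_int (a $ k) * (omega n ^ l) ^ k)" for l
  define C where "C = map_mat (of_int :: int \<Rightarrow> complex) (circulant_mat n a)"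
  define V where "V = mat n n (\<lambda>(i, j). omega n ^ (i * j))"
  define W where "W = mat n n (\<lambda>(i, j). inverse (omega n) ^ (i * j))"
  define D where "D = mat n n (\<lambda>(i, j). if i = j then ev i else 0)"
  have carr [simp]: "C \<in> carrier_mat n n" "V \<in> carrier_mat n n" "W \<in> carrier_mat n n" "D \<in> carrier_mat n n"
    by (auto simp: C_def V_def W_def D_def circulant_mat_def)
  have "V * W = of_nat n \<cdot>\<^sub>m 1\<^sub>m n"
  proof (rule eq_matI)
    fix i j assume "i < dim_row (of_nat n \<cdot>\<^sub>m 1\<^sub>m n :: complex mat)" "j < dim_col (of_nat n \<cdot>\<^sub>m 1\<^sub>m n :: complex mat)"
    then have ij: "i < n" "j < n" by auto
    have "(V * W) $$ (i, j) = (\<Sum>k<n. omega n ^ (i * k) * inverse (omega n) ^ (k * j))"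
      using ij by (simp add: V_def W_def scalar_prod_def lessThan_atLeast0)
    also have "\<dots> = (\<Sum>k<n. (omega n ^ i / omega n ^ j) ^ k)"
      by (simp add: power_mult [symmetric] power_divide field_simps power_inverse)
    also have "\<dots> = (if i = j then of_nat n else 0)"
    proof (cases "i = j")
      case False
      have neq: "omega n ^ i \<noteq> omega n ^ j" if "i < j" "j < n" for i j
      proof
        assume "omega n ^ i = omega n ^ j"
        moreover have "omega n ^ j = omega n ^ i * omega n ^ (j - i)"
          using that by (simp flip: power_add)
        ultimately have "omega n ^ (j - i) = 1"
          by simp
        then have "n dvd j - i"
          using omega_power_eq_1_iff n by blast
        then show False
          using that by (auto dest: dvd_imp_le)
      qed
      have "omega n ^ i / omega n ^ j \<noteq> 1"
        using neq[of i j] neq[of j i] ij False by (cases "i < j") auto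
      moreover have "(omega n ^ i / omega n ^ j) ^ n = 1"
        by (simp add: power_divide)
      ultimately have "(\<Sum>k<n. (omega n ^ i / omega n ^ j) ^ k) = 0"
        by (intro sum_powers_root_of_unity)
      then show ?thesis
        using False by simp
    qed simp
    also have "\<dots> = (of_nat n \<cdot>\<^sub>m 1\<^sub>m n) $$ (i, j)"
      using ij by simp
    finally show "(V * W) $$ (i, j) = (of_nat n \<cdot>\<^sub>m 1\<^sub>m n) $$ (i, j)" .
  qed (auto simp: V_def W_def)
  then have "det V * det W = of_nat n ^ n"
    by (simp flip: det_mult[of V n W])
  then have V0: "det V \<noteq> 0"
    using n by auto
  have "C * V = V * D"
  proof (rule eq_matI)
    fix i l assume "i < dim_row (V * D)" "l < dim_col (V * D)"
    then have il: "i < n" "l < n" by (auto simp: V_def D_def)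
    have "(C * V) $$ (i, l) = (\<Sum>j<n. of_int (a $ nat ((int j - int i) mod int n)) * omega n ^ (j * l))"
      using il by (simp add: C_def V_def circulant_mat_def scalar_prod_def lessThan_atLeast0)
    also have "\<dots> = (\<Sum>k<n. of_int (a $ k) * omega n ^ ((i + k) mod n * l))"
    proof (rule sum.reindex_bij_witness[where i = "\<lambda>k. (i + k) mod n"
          and j = "\<lambda>j. nat ((int j - int i) mod int n)"])
      fix j assume "j \<in> {..<n}"
      then have "(int i + (int j - int i) mod int n) mod int n = int j"
        by (simp add: mod_add_right_eq)
      then have "int ((i + nat ((int j - int i) mod int n)) mod n) = int j"
        using n by (simp add: zmod_int)
      then show "(i + nat ((int j - int i) mod int n)) mod n = j"
        by (simp only: of_nat_eq_iff)
      then show "of_int (a $ nat ((int j - int i) mod int n))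
          * omega n ^ ((i + nat ((int j - int i) mod int n)) mod n * l)
        = of_int (a $ nat ((int j - int i) mod int n)) * omega n ^ (j * l)"
        by simp
      show "nat ((int j - int i) mod int n) \<in> {..<n}"
        using n by (simp add: nat_less_iff)
    next
      fix k assume "k \<in> {..<n}"
      then show "nat ((int ((i + k) mod n) - int i) mod int n) = k"
        by (simp add: zmod_int mod_diff_left_eq)
      show "(i + k) mod n \<in> {..<n}"
        using n by simp
    qed
    also have "\<dots> = (\<Sum>k<n. of_int (a $ k) * (omega n ^ (i * l) * (omega n ^ l) ^ k))"
    proof (rule sum.cong)
      fix k
      have "omega n ^ ((i + k) mod n * l) = (omega n ^ ((i + k) mod n)) ^ l"
        by (simp only: power_mult)
      also have "\<dots> = (omega n ^ (i + k)) ^ l"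
        by (simp only: omega_power_mod[OF n])
      also have "\<dots> = omega n ^ (i * l) * (omega n ^ l) ^ k"
        by (simp add: power_add algebra_simps flip: power_mult)
      finally show "of_int (a $ k) * omega n ^ ((i + k) mod n * l) = of_int (a $ k) * (omega n ^ (i * l) * (omega n ^ l) ^ k)"
        by simp
    qed simp
    also have "\<dots> = omega n ^ (i * l) * ev l"
      by (simp add: ev_def sum_distrib_left algebra_simps)
    also have "\<dots> = (\<Sum>k<n. if k = l then omega n ^ (i * k) * ev k else 0)"
      using il by simp
    also have "\<dots> = (V * D) $$ (i, l)"
      using il by (simp add: V_def D_def scalar_prod_def lessThan_atLeast0 if_distrib cong: if_cong)
    finally show "(C * V) $$ (i, l) = (V * D) $$ (i, l)" .
  qed (auto simp: C_def V_def D_def circulant_mat_def)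
  then have "det C * det V = det V * det D"
    by (metis det_mult carr(1,2,4))
  with V0 have "det C = det D"
    by simp
  also have "\<dots> = prod_list (diag_mat D)"
    by (rule det_upper_triangular[of _ n]) (auto simp: D_def upper_triangular_def)
  also have "\<dots> = (\<Prod>l<n. ev l)"
    by (simp add: diag_mat_def D_def prod.list_conv_set_nth lessThan_atLeast0)
  finally show ?thesis
    by (simp add: C_def ev_def of_int_hom.hom_det)
qed

abbreviation ceval :: "int poly \<Rightarrow> complex \<Rightarrow> complex" where
  "ceval F z \<equiv> poly (of_int_poly F) z"

text \<open>Folding the coefficients of \<open>F\<close> along residues of the exponents modulo
  \<open>n\<close> keeps all values at \<open>n\<close>-th roots of unity, so \<open>F\<close> may
  have any degree.\<close>

lemma circulant_detsI:
  assumes n: "n > 0" and D: "of_int D = (\<Prod>l<n. ceval F (omega n ^ l))"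
  shows "D \<in> circulant_dets n"
proof -
  define a where "a = vec n (\<lambda>k. \<Sum>i | i \<le> degree F \<and> i mod n = k. coeff F i)"
  have "(\<Sum>k<n. of_int (a $ k) * z ^ k) = ceval F z" if z: "z ^ n = 1" for z :: complex
  proof -
    have zmod: "z ^ (i mod n) = z ^ i" for i
    proof -
      have "z ^ i = z ^ (n * (i div n) + i mod n)"
        by simp
      also have "\<dots> = z ^ (i mod n)"
        by (simp only: power_add power_mult z) simp
      finally show ?thesis ..
    qed
    have "ceval F z = (\<Sum>i\<le>degree F. of_int (coeff F i) * z ^ i)"
      by (simp add: poly_altdef)
    also have "\<dots> = (\<Sum>k<n. \<Sum>i | i \<in> {..degree F} \<and> i mod n = k. of_int (coeff F i) * z ^ i)"
      by (rule sum.group[symmetric]) (use n in auto)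
    also have "\<dots> = (\<Sum>k<n. of_int (a $ k) * z ^ k)"
      unfolding a_def by (rule sum.cong) (auto simp: sum_distrib_right zmod intro!: sum.cong)
    finally show ?thesis ..
  qed
  then have "of_int D = (of_int (det (circulant_mat n a)) :: complex)"
    by (simp add: D det_circulant_mat[OF n])
  then have "D = det (circulant_mat n a)"
    by simp
  moreover have "a \<in> carrier_vec n"
    by (simp add: a_def)
  ultimately show ?thesis
    by (auto simp: circulant_dets_def)
qed

section \<open>Norms at primitive roots of unity\<close>

text \<open>For \<open>l\<close> in \<open>orbit n d\<close> the powers \<open>omega n ^ l\<close> are the primitive roots of unity of order \<open>n div d\<close>, so
  \<open>orbit_prod n d F\<close> is the norm of \<open>F\<close> at these roots.\<close>

definition orbit :: "nat \<Rightarrow> nat \<Rightarrow> nat set" where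
  "orbit n d = {l. l < n \<and> gcd l n = d}"

definition orbit_prod :: "nat \<Rightarrow> nat \<Rightarrow> int poly \<Rightarrow> complex" where
  "orbit_prod n d F = (\<Prod>l\<in>orbit n d. ceval F (omega n ^ l))"

lemma finite_orbit [simp]: "finite (orbit n d)"
  by (simp add: orbit_def)

lemma orbit_prod_mult: "orbit_prod n d (F * G) = orbit_prod n d F * orbit_prod n d G"
  by (simp add: orbit_prod_def prod.distrib of_int_poly_hom.hom_mult)

lemma orbit_prod_power: "orbit_prod n d (F ^ k) = orbit_prod n d F ^ k"
  by (simp add: orbit_prod_def prod_power_distrib of_int_poly_hom.hom_power)

text \<open>A factor prime to \<open>n\<close> does not change the gcd with \<open>n\<close>, so
  multiplication by \<open>a\<close> modulo \<open>n\<close> permutes the orbit.\<close>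

lemma prod_orbit_mult:
  assumes "n > 0" and "coprime a n"
  shows "(\<Prod>l\<in>orbit n d. f (omega n ^ (a * l))) = (\<Prod>l\<in>orbit n d. f (omega n ^ l))"
proof -
  define h where "h l = a * l mod n" for l
  have "inj_on h (orbit n d)"
  proof
    fix x y assume "x \<in> orbit n d" "y \<in> orbit n d" "h x = h y"
    then have "[a * x = a * y] (mod n)" and "x < n" "y < n"
      by (auto simp: h_def orbit_def cong_def)
    then show "x = y"
      using assms by (metis cong_def cong_mult_lcancel_nat mod_less)
  qed
  moreover have "h ` orbit n d \<subseteq> orbit n d"
    using assms by (auto simp: h_def orbit_def gcd_mult_left_left_cancel coprime_commute)
  ultimately have "bij_betw h (orbit n d) (orbit n d)"
    by (simp add: bij_betw_def endo_inj_surj)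
  then have "(\<Prod>l\<in>orbit n d. f (omega n ^ h l)) = (\<Prod>l\<in>orbit n d. f (omega n ^ l))"
    by (rule prod.reindex_bij_betw)
  then show ?thesis
    using assms by (simp add: h_def omega_power_mod)
qed

section \<open>Cyclotomic units and their norms\<close>

definition geom :: "nat \<Rightarrow> nat \<Rightarrow> int poly" where
  "geom a c = (\<Sum>i<a. monom 1 (c * i))"

lemma ceval_geom: "ceval (geom a c) z = (\<Sum>i<a. (z ^ c) ^ i)"
  by (simp add: geom_def of_int_poly_hom.hom_sum poly_sum poly_monom power_mult)

lemma ceval_geom_eq_of_nat: "z ^ c = 1 \<Longrightarrow> ceval (geom a c) z = of_nat a"
  by (simp add: ceval_geom)

lemma ceval_geom_eq_0: "z ^ c \<noteq> 1 \<Longrightarrow> z ^ (c * a) = 1 \<Longrightarrow> ceval (geom a c) z = 0"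
  by (simp add: ceval_geom sum_powers_root_of_unity power_mult)

lemma omega_power_orbit_eq_1_iff:
  assumes "l \<in> orbit n d"
  shows "(omega n ^ l) ^ c = 1 \<longleftrightarrow> n dvd c * d"
proof -
  from assms have l: "l < n" "gcd l n = d"
    by (auto simp: orbit_def)
  have "n dvd c * l \<longleftrightarrow> n dvd gcd (c * l) (c * n)"
    by simp
  also have "gcd (c * l) (c * n) = c * d"
    using l by (simp add: gcd_mult_distrib_nat[symmetric])
  finally show ?thesis
    using l by (simp add: omega_power_eq_1_iff mult.commute flip: power_mult)
qed

text \<open>Multiplication by \<open>a\<close> permutes the orbit, so the product of the quotients
  \<open>(z\<^bsup>ac\<^esup> - 1) / (z\<^sup>c - 1)\<close> telescopes.\<close>

lemma orbit_prod_geom: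
  assumes "n > 0" and "coprime a n" and "\<not> n dvd c * d"
  shows "orbit_prod n d (geom a c) = 1"
proof -
  have ne: "(omega n ^ l) ^ c - 1 \<noteq> 0" if "l \<in> orbit n d" for l
    using that assms by (simp add: omega_power_orbit_eq_1_iff)
  have "orbit_prod n d (geom a c) = (\<Prod>l\<in>orbit n d. ((omega n ^ (a * l)) ^ c - 1) / ((omega n ^ l) ^ c - 1))"
    unfolding orbit_prod_def
  proof (rule prod.cong)
    fix l assume "l \<in> orbit n d"
    then have "ceval (geom a c) (omega n ^ l) = (((omega n ^ l) ^ c) ^ a - 1) / ((omega n ^ l) ^ c - 1)"
      using ne by (simp add: ceval_geom geometric_sum)
    also have "((omega n ^ l) ^ c) ^ a = (omega n ^ (a * l)) ^ c"
      by (simp only: power_mult[symmetric] mult_ac)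
    finally show "ceval (geom a c) (omega n ^ l) =
        ((omega n ^ (a * l)) ^ c - 1) / ((omega n ^ l) ^ c - 1)" .
  qed simp
  also have "\<dots> = (\<Prod>l\<in>orbit n d. (omega n ^ (a * l)) ^ c - 1) / (\<Prod>l\<in>orbit n d. (omega n ^ l) ^ c - 1)"
    by (rule prod_dividef)
  also have "(\<Prod>l\<in>orbit n d. (omega n ^ (a * l)) ^ c - 1) = (\<Prod>l\<in>orbit n d. (omega n ^ l) ^ c - 1)"
    by (rule prod_orbit_mult[OF assms(1,2)])
  also have "\<dots> / \<dots> = 1"
    using ne by (simp add: prod_zero_iff)
  finally show ?thesis .
qed

text \<open>As \<open>n\<close> is odd, doubling permutes the orbit, so the norm \<open>P\<close> is
  nonzero with \<open>P * P = P\<close>.\<close>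

lemma orbit_prod_monom:
  assumes "odd n"
  shows "orbit_prod n d (monom 1 j) = 1"
proof -
  define P where "P = (\<Prod>l\<in>orbit n d. (omega n ^ l) ^ j)"
  have "n > 0" "coprime 2 n"
    using assms by (auto intro: Nat.gr0I)
  then have "(\<Prod>l\<in>orbit n d. (omega n ^ (2 * l)) ^ j) = P"
    unfolding P_def by (rule prod_orbit_mult)
  then have "P * P = P"
    by (simp add: P_def mult_2 power_add power_mult_distrib prod.distrib)
  moreover have "P \<noteq> 0"
    by (simp add: P_def prod_zero_iff)
  ultimately show ?thesis
    by (simp add: orbit_prod_def P_def poly_monom)
qed

section \<open>Norms of \<open>1 - x\<close> and the splitting into orbits\<close>

lemma prod_one_minus_powers:
  fixes z :: complex
  assumes n: "n > 0" and z: "\<And>i. z ^ i = 1 \<longleftrightarrow> n dvd i"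
  shows "(\<Prod>l\<in>{1..<n}. 1 - z ^ l) = of_nat n"
proof -
  \<comment> \<open>Both \<open>P\<close> and \<open>Q\<close> are the monic polynomial
    \<open>(x^n - 1)/(x - 1)\<close>: they agree at its \<open>n - 1\<close> distinct roots. The
    claim is their equality at 1.\<close>
  define P where "P = (\<Prod>l\<in>{1..<n}. [:- (z ^ l), 1:])"
  define Q :: "complex poly" where "Q = (\<Sum>i<n. monom 1 i)"
  have z0: "z \<noteq> 0"
    using z[of n] n by (auto simp: zero_power)
  have inj: "inj_on (\<lambda>l. z ^ l) {1..<n}"
  proof (rule linorder_inj_onI)
    fix i j assume "i < j" "i \<in> {1..<n}" "j \<in> {1..<n}"
    moreover have "z ^ j = z ^ i * z ^ (j - i)" if "i < j"
      using that by (simp flip: power_add)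
    ultimately show "z ^ i \<noteq> z ^ j"
      using z0 z[of "j - i"] by (auto dest: dvd_imp_le)
  qed auto
  have degP: "degree P = n - 1"
    unfolding P_def by (subst degree_prod_eq_sum_degree) auto
  have coeffQ: "coeff Q i = (if i < n then 1 else 0)" for i
    by (simp add: Q_def coeff_sum if_distrib cong: if_cong)
  have degQ: "degree Q = n - 1"
    using n by (intro antisym degree_le le_degree) (auto simp: coeffQ)
  have "P = Q"
  proof (rule poly_eqI_degree_lead_coeff[where A = "(\<lambda>l. z ^ l) ` {1..<n}" and n = "n - 1"])
    show "card ((\<lambda>l. z ^ l) ` {1..<n}) \<ge> n - 1"
      using inj by (simp add: card_image)
    show "poly P x = poly Q x" if "x \<in> (\<lambda>l. z ^ l) ` {1..<n}" for x
    proof -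
      from that obtain l where l: "l \<in> {1..<n}" "x = z ^ l"
        by auto
      then have "poly P x = 0"
        by (auto simp: P_def poly_prod prod_zero_iff)
      moreover have "poly Q x = (\<Sum>i<n. x ^ i)"
        by (simp add: Q_def poly_sum poly_monom)
      moreover have "(\<Sum>i<n. x ^ i) = 0"
        using l z[of l] z[of "l * n"]
        by (intro sum_powers_root_of_unity) (auto simp: power_mult dest: dvd_imp_le)
      ultimately show ?thesis by simp
    qed
    have "lead_coeff P = 1"
      by (simp add: P_def lead_coeff_prod)
    then show "coeff P (n - 1) = coeff Q (n - 1)"
      using n by (simp add: coeffQ degP)
  qed (auto simp: degP degQ)
  then have "poly P 1 = poly Q 1"
    by simp
  then show ?thesis
    by (simp add: P_def Q_def poly_prod poly_sum poly_monom)
qed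

lemma orbit_prime_mult:
  assumes "prime p" and "q > 0"
  shows "orbit (p * q) q = (\<lambda>j. q * j) ` {1..<p}"
proof (intro equalityI subsetI)
  fix l assume "l \<in> orbit (p * q) q"
  then have l: "l < p * q" "gcd l (p * q) = q"
    by (auto simp: orbit_def)
  then have "q dvd l"
    by (metis gcd_dvd1)
  then obtain j where j: "l = q * j" ..
  have "j \<noteq> 0"
    using l assms prime_gt_1_nat[OF assms(1)] by (intro notI) (simp add: j)
  moreover have "j < p"
    using l by (simp add: j mult.commute)
  ultimately show "l \<in> (\<lambda>j. q * j) ` {1..<p}"
    using j by auto
next
  fix l assume "l \<in> (\<lambda>j. q * j) ` {1..<p}"
  then obtain j where "j \<in> {1..<p}" and j: "l = q * j"
    by blast
  then have j': "0 < j" "j < p"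
    by auto
  have "coprime j p"
    using assms j' by (metis coprime_commute nat_dvd_not_less prime_imp_coprime)
  then have "gcd (q * j) (q * p) = q"
    by (simp add: gcd_mult_distrib_nat[symmetric])
  then show "l \<in> orbit (p * q) q"
    using j j' assms by (simp add: orbit_def mult.commute)
qed

lemma orbit_prod_one_minus_prime:
  assumes "prime p" and "q > 0"
  shows "orbit_prod (p * q) q [:1, -1:] = of_nat p"
proof -
  have p: "p > 0"
    using assms by (simp add: prime_gt_0_nat)
  have "orbit_prod (p * q) q [:1, -1:] = (\<Prod>j\<in>{1..<p}. 1 - (omega (p * q) ^ q) ^ j)"
    using assms by (simp add: orbit_prod_def orbit_prime_mult prod.reindex inj_on_def power_mult)
  also have "\<dots> = of_nat p"
    using assms p by (intro prod_one_minus_powers) (auto simp: omega_power_eq_1_iff mult.commute simp flip: power_mult)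
  finally show ?thesis .
qed

lemma prod_split_orbits:
  fixes f :: "nat \<Rightarrow> complex"
  assumes "prime p" and "prime q" and "p \<noteq> q"
  shows "(\<Prod>l<p * q. f l) =
    f 0 * (\<Prod>l\<in>orbit (p * q) q. f l) * (\<Prod>l\<in>orbit (p * q) p. f l) * (\<Prod>l\<in>orbit (p * q) 1. f l)"
proof -
  have pq: "p > 1" "q > 1"
    using assms prime_gt_1_nat by blast+
  have dvd: "d \<in> {p * q, q, p, 1}" if "d dvd p * q" for d
  proof -
    obtain a b where "d = a * b" "a dvd p" "b dvd q"
      using division_decomp \<open>d dvd p * q\<close> by blast
    moreover from this have "a = 1 \<or> a = p" "b = 1 \<or> b = q"
      using assms by (auto simp: prime_nat_iff)
    ultimately show ?thesis
      by auto
  qed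
  have "{..<p * q} = {0} \<union> orbit (p * q) q \<union> orbit (p * q) p \<union> orbit (p * q) 1" (is "_ = ?R")
  proof (intro equalityI subsetI)
    fix l assume "l \<in> {..<p * q}"
    moreover from this have "gcd l (p * q) = p * q \<Longrightarrow> l = 0"
      by (metis gcd_dvd1 lessThan_iff nat_dvd_not_less neq0_conv)
    ultimately show "l \<in> ?R"
      using dvd[of "gcd l (p * q)"] by (auto simp: orbit_def)
  qed (use pq in \<open>auto simp: orbit_def\<close>)
  moreover have "0 \<notin> orbit (p * q) q" "0 \<notin> orbit (p * q) p" "0 \<notin> orbit (p * q) 1"
    "orbit (p * q) q \<inter> orbit (p * q) p = {}" "orbit (p * q) q \<inter> orbit (p * q) 1 = {}"
    "orbit (p * q) p \<inter> orbit (p * q) 1 = {}"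
    using pq assms(3) by (auto simp: orbit_def)
  ultimately show ?thesis
    by (simp add: prod.union_disjoint Int_Un_distrib2 mult.assoc del: Un_insert_left)
qed

text \<open>The product of \<open>1 - omega (p * q) ^ l\<close> over all nonzero \<open>l\<close> is
  \<open>p * q\<close>, and the orbits of orders \<open>p\<close> and \<open>q\<close> already
  contribute \<open>p\<close> and \<open>q\<close>.\<close>

lemma orbit_prod_one_minus_coprime:
  assumes "prime p" and "prime q" and "p \<noteq> q"
  shows "orbit_prod (p * q) 1 [:1, -1:] = 1"
proof -
  have pq: "p > 0" "q > 0"
    using assms by (auto simp: prime_gt_0_nat)
  \<comment> \<open>The value 1 at \<open>l = 0\<close> replaces the vanishing factor, so that
    \<open>prod_split_orbits\<close> still yields information.\<close>
  define f where "f l = (if l = 0 then 1 else 1 - omega (p * q) ^ l)" for l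
  have f: "(\<Prod>l\<in>orbit (p * q) d. f l) = orbit_prod (p * q) d [:1, -1:]" if "d \<noteq> p * q" for d
    unfolding orbit_prod_def by (rule prod.cong) (use that in \<open>auto simp: f_def orbit_def intro!: Nat.gr0I\<close>)
  have "(\<Prod>l<p * q. f l) = (\<Prod>l\<in>insert 0 {1..<p * q}. f l)"
    by (rule prod.cong) (use pq in auto)
  also have "\<dots> = (\<Prod>l\<in>{1..<p * q}. 1 - omega (p * q) ^ l)"
    by (simp add: f_def)
  also have "\<dots> = of_nat (p * q)"
    by (rule prod_one_minus_powers) (use pq omega_power_eq_1_iff in auto)
  finally have "of_nat (p * q) = (\<Prod>l<p * q. f l)" ..
  also have "\<dots> = of_nat (p * q) * orbit_prod (p * q) 1 [:1, -1:]"
    using orbit_prod_one_minus_prime[of p q] orbit_prod_one_minus_prime[of q p, unfolded mult.commute[of q p]] assms pq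
      prime_gt_1_nat[OF assms(1)] prime_gt_1_nat[OF assms(2)]
    by (simp add: prod_split_orbits f) (simp add: f_def)
  finally show ?thesis
    using pq by simp
qed

lemma prod_ceval_omega:
  assumes "prime p" and "prime q" and "p \<noteq> q"
  shows "(\<Prod>l<p * q. ceval F (omega (p * q) ^ l)) =
    of_int (poly F 1) * orbit_prod (p * q) q F * orbit_prod (p * q) p F * orbit_prod (p * q) 1 F"
proof -
  have "ceval F 1 = of_int (poly F 1)"
    by simp
  then show ?thesis
    using assms by (simp add: prod_split_orbits orbit_prod_def)
qed

section \<open>Realizing multiples of cubes\<close>

lemma cube_mult_in_circulant_detsI:
  fixes p q :: nat and t m :: int
  assumes p: "prime p" and q: "prime q" and pq: "p \<noteq> q"
    and F1: "poly F 1 = int p * t" and t: "\<not> int q dvd t"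
    and Fq: "orbit_prod (p * q) q F = of_nat p ^ 2"
    and Fp: "orbit_prod (p * q) p F = 1"
    and Fpq: "orbit_prod (p * q) 1 F = 1"
    and m: "gcd m (int q) = 1"
  shows "int p ^ 3 * m \<in> circulant_dets (p * q)"
proof -
  have gt1: "p > 1" "q > 1"
    using p q prime_gt_1_nat by blast+
  then have n: "p * q > 0"
    by simp
  have cop: "coprime p q"
    using p q pq by (simp add: primes_coprime)
  have "coprime t (int q)"
    using q t by (metis coprime_commute prime_imp_coprime prime_nat_int_transfer)
  then obtain s where s: "[t * s = 1] (mod int q)"
    using cong_solve_coprime_int by blast
  \<comment> \<open>The first congruence makes \<open>a\<close> prime to \<open>p\<close>; the
    second gives \<open>a * t = m\<close> modulo \<open>q\<close>, which also makes \<open>a\<close>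
    prime to \<open>q\<close>.\<close>
  obtain a where a: "[a = 1] (mod p)" "[a = nat (s * m mod int q)] (mod q)"
    using binary_chinese_remainder_nat[OF cop] by blast
  have "[int a = int (nat (s * m mod int q))] (mod int q)"
    using a(2) by (simp only: cong_int_iff)
  then have aq: "[int a = s * m] (mod int q)"
    using gt1 by (simp add: cong_def)
  then have "[int a * t = s * m * t] (mod int q)"
    by (rule cong_scalar_right)
  also have "[s * m * t = m] (mod int q)"
    using cong_scalar_right[OF s, of m] by (simp add: mult_ac)
  finally have at: "[int a * t = m] (mod int q)" .
  have "coprime a p"
    using a(1) by (metis cong_imp_coprime cong_sym coprime_1_left)
  moreover have "coprime (int a * t) (int q)"
    using at m by (metis cong_imp_coprime cong_sym coprime_iff_gcd_eq_1)
  then have "coprime a q"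
    by simp
  ultimately have acop: "coprime a (p * q)"
    by simp
  obtain h where h: "m = int a * t + int q * h"
    using at by (metis cong_iff_lin cong_sym mult.commute)
  \<comment> \<open>The second summand vanishes at every \<open>n\<close>-th root of unity except 1,
    where it adds \<open>p * q * h\<close> and corrects \<open>p * a * t\<close> to
    \<open>p * m\<close>.\<close>
  define G where "G = F * geom a 1 + [:h:] * geom (p * q) 1"
  have geom1: "poly (geom b c) 1 = int b" for b c
    by (simp add: geom_def poly_sum poly_monom)
  have G: "orbit_prod (p * q) d G = orbit_prod (p * q) d F" if d: "d \<in> {p, q, 1}" for d
  proof -
    have d': "\<not> p * q dvd 1 * d"
      using d gt1 by (auto dest: dvd_imp_le)
    have "orbit_prod (p * q) d G = orbit_prod (p * q) d (F * geom a 1)"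
      unfolding orbit_prod_def
    proof (rule prod.cong)
      fix l assume "l \<in> orbit (p * q) d"
      then have "(omega (p * q) ^ l) ^ 1 \<noteq> 1"
        using d' omega_power_orbit_eq_1_iff by blast
      then have "ceval (geom (p * q) 1) (omega (p * q) ^ l) = 0"
        by (rule ceval_geom_eq_0) simp
      then show "ceval G (omega (p * q) ^ l) = ceval (F * geom a 1) (omega (p * q) ^ l)"
        by (simp add: G_def hom_distribs)
    qed simp
    then show ?thesis
      using n acop d' by (simp add: orbit_prod_mult orbit_prod_geom)
  qed
  have "poly G 1 = int p * m"
    by (simp add: G_def geom1 F1 h algebra_simps)
  then have "of_int (int p ^ 3 * m) = (\<Prod>l<p * q. ceval G (omega (p * q) ^ l))"
    unfolding prod_ceval_omega[OF p q pq]
    using Fq Fp Fpq by (simp add: G power3_eq_cube power2_eq_square)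
  then show ?thesis
    using circulant_detsI n by blast
qed

text \<open>The witness is \<open>F = x\<^sup>j (1 - x)\<^sup>2 (x\<^bsup>qk\<^esup> - 1)/(x\<^sup>q - 1) + g (x\<^bsup>pq\<^esup> - 1)/(x\<^sup>q - 1)\<close>. The second
  summand vanishes unless \<open>x\<^sup>q = 1\<close>; at primitive \<open>q\<close>-th roots of unity \<open>F = k x\<^sup>j (1 - x)\<^sup>2 + p g = V\<close>.\<close>

lemma cube_mult_in_circulant_dets_of_unit:
  fixes p q k j :: nat and m :: int and V g Q :: "int poly"
  assumes p: "prime p" and q: "prime q" and pq: "p \<noteq> q" and odd: "odd (p * q)"
    and k: "coprime k (p * q)"
    and V: "V = smult (int k) (monom 1 j * [:1, -1:] ^ 2) + smult (int p) g + geom q 1 * Q"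
    and unit: "orbit_prod (p * q) p V = 1"
    and g: "\<not> int q dvd poly g 1"
    and m: "gcd m (int q) = 1"
  shows "int p ^ 3 * m \<in> circulant_dets (p * q)"
proof -
  have gt1: "p > 1" "q > 1"
    using p q prime_gt_1_nat by blast+
  then have n: "p * q > 0"
    by simp
  have nq: "\<not> p * q dvd q * 1" "\<not> p * q dvd q * q"
    using p q pq gt1 by (auto dest: dvd_imp_le simp: primes_dvd_imp_eq)
  define F where "F = monom 1 j * [:1, -1:] ^ 2 * geom k q + g * geom p q"
  have F: "orbit_prod (p * q) d F = orbit_prod (p * q) d [:1, -1:] ^ 2" if d: "d \<in> {q, 1}" for d
  proof -
    have "orbit_prod (p * q) d F = orbit_prod (p * q) d (monom 1 j * [:1, -1:] ^ 2 * geom k q)"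
      unfolding orbit_prod_def
    proof (rule prod.cong)
      fix l assume "l \<in> orbit (p * q) d"
      then have "(omega (p * q) ^ l) ^ q \<noteq> 1"
        using d nq omega_power_orbit_eq_1_iff by blast
      then have "ceval (geom p q) (omega (p * q) ^ l) = 0"
        by (rule ceval_geom_eq_0) (simp add: mult.commute)
      then show "ceval F (omega (p * q) ^ l) =
          ceval (monom 1 j * [:1, -1:] ^ 2 * geom k q) (omega (p * q) ^ l)"
        by (simp add: F_def hom_distribs)
    qed simp
    also have "orbit_prod (p * q) d (geom k q) = 1"
      using n k nq d by (intro orbit_prod_geom) auto
    then have "orbit_prod (p * q) d (monom 1 j * [:1, -1:] ^ 2 * geom k q) = orbit_prod (p * q) d [:1, -1:] ^ 2"
      using odd by (simp add: orbit_prod_mult orbit_prod_power orbit_prod_monom)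
    finally show ?thesis .
  qed
  have "orbit_prod (p * q) p F = orbit_prod (p * q) p V"
    unfolding orbit_prod_def
  proof (rule prod.cong)
    fix l assume l: "l \<in> orbit (p * q) p"
    define z where "z = omega (p * q) ^ l"
    have zq: "z ^ q = 1"
      using l omega_power_orbit_eq_1_iff[of l "p * q" p q] by (simp add: z_def mult.commute)
    have "\<not> p * q dvd 1 * p"
      using gt1 by (auto dest: dvd_imp_le)
    then have "z ^ 1 \<noteq> 1"
      using l omega_power_orbit_eq_1_iff unfolding z_def by blast
    \<comment> \<open>This removes the term with \<open>Q\<close>: the unit \<open>V\<close> has to
      be matched only modulo the \<open>q\<close>-th cyclotomic polynomial.\<close>
    then have "ceval (geom q 1) z = 0"
      using zq by (intro ceval_geom_eq_0) auto
    then have "ceval F z = ceval V z"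
      using ceval_geom_eq_of_nat[OF zq]
      by (simp add: F_def V hom_distribs algebra_simps)
    then show "ceval F (omega (p * q) ^ l) = ceval V (omega (p * q) ^ l)"
      by (simp add: z_def)
  qed simp
  moreover have "poly F 1 = int p * poly g 1"
    by (simp add: F_def geom_def poly_sum poly_monom)
  ultimately show ?thesis
    using assms F orbit_prod_one_minus_prime[OF p, of q] orbit_prod_one_minus_coprime[OF p q pq] gt1
    by (intro cube_mult_in_circulant_detsI[of p q F "poly g 1"]) auto
qed

section \<open>The case \<open>n = 3 * p\<close>\<close>

lemma cube_mult_in_circulant_dets_3:
  fixes p :: nat and m :: int
  assumes p: "prime p" and "odd p" and "p \<noteq> 3" and m: "gcd m 3 = 1"
  shows "int p ^ 3 * m \<in> circulant_dets (p * 3)"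
proof -
  have "coprime 3 p"
    using p \<open>p \<noteq> 3\<close> by (simp add: primes_coprime)
  have "coprime 3 (int p)"
    using \<open>coprime 3 p\<close> by (metis coprime_int_iff of_nat_numeral)
  obtain s where s: "[3 * s = - 1] (mod int p)"
  proof -
    obtain s where "[3 * s = 1] (mod int p)"
      using cong_solve_coprime_int[OF \<open>coprime 3 (int p)\<close>] by blast
    then have "[3 * - s = - 1] (mod int p)"
      by (metis cong_minus_minus_iff mult_minus_right)
    then show thesis
      using that by blast
  qed
  \<comment> \<open>The residue 1 modulo 3 only serves to make \<open>k\<close> prime to 3; modulo
    \<open>p\<close>, \<open>k\<close> must be the inverse of -3.\<close>
  obtain k where k: "[k = 1] (mod 3)" "[k = nat (s mod int p)] (mod p)"
    using binary_chinese_remainder_nat[OF \<open>coprime 3 p\<close>] by blast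
  have "[int k = int (nat (s mod int p))] (mod int p)"
    using k(2) by (simp only: cong_int_iff)
  then have "[int k = s] (mod int p)"
    using p by (simp add: cong_def prime_gt_0_nat)
  then have "[3 * int k = - 1] (mod int p)"
    using s cong_scalar_left cong_trans by blast
  then obtain t where t: "3 * int k + 1 = int p * t"
    by (auto simp: cong_iff_dvd_diff)
  have "coprime k 3"
    using k(1) by (metis cong_imp_coprime cong_sym coprime_1_left)
  moreover have "coprime (int k) (int p)"
  proof (rule coprimeI)
    fix c assume "c dvd int k" "c dvd int p"
    then have "c dvd int p * t - 3 * int k"
      by (intro dvd_diff) auto
    then show "is_unit c"
      by (simp flip: t)
  qed
  ultimately have "coprime k (p * 3)"
    by simp
  moreover have "\<not> 3 dvd t"
  proof
    assume "3 dvd t"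
    then have "3 dvd int p * t - 3 * int k"
      by (intro dvd_diff) auto
    then show False
      by (simp flip: t)
  qed
  \<comment> \<open>The unit is \<open>x\<close> itself: modulo \<open>1 + x + x^2\<close> one has
    \<open>k (1 - x)^2 = -3 k x\<close>, and \<open>3 k + 1 = p t\<close>.\<close>
  moreover have "monom 1 1 = smult (int k) (monom 1 0 * [:1, -1:] ^ 2) + smult (int p) [:0, t:] + geom 3 1 * [:- int k:]"
    using t by (simp add: geom_def numeral_3_eq_3 monom_Suc monom_0 power2_eq_square one_pCons)
  moreover have "orbit_prod (p * 3) p (monom 1 1) = 1"
    using \<open>odd p\<close> by (intro orbit_prod_monom) simp
  ultimately show ?thesis
    using assms
    by (intro cube_mult_in_circulant_dets_of_unit[of p 3 k "monom 1 1" 0 "[:0, t:]" "[:- int k:]"])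
      simp_all
qed

text \<open>\<open>1 + x^3 + x^6\<close> is 3 at both primitive cube roots of unity and at 1. At
  roots of order \<open>p\<close> and \<open>3 * p\<close> it is \<open>1 + y + y^2\<close> with
  \<open>y = x^3\<close> of order \<open>p\<close>, a unit.\<close>

lemma cube_mult_in_circulant_dets_27:
  fixes p :: nat and m :: int
  assumes p: "prime p" and "p \<noteq> 3" and m: "gcd m (int p) = 1"
  shows "3 ^ 3 * m \<in> circulant_dets (3 * p)"
proof -
  have gt1: "p > 1"
    using p prime_gt_1_nat by blast
  have 3: "prime (3 :: nat)"
    by simp
  have cop: "coprime 3 p"
    using p \<open>p \<noteq> 3\<close> by (simp add: primes_coprime)
  have np: "\<not> p dvd 3"
    using p 3 \<open>p \<noteq> 3\<close> primes_dvd_imp_eq by blast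
  have "orbit_prod (3 * p) p (geom 3 3) = (\<Prod>l\<in>orbit (3 * p) p. 3)"
    unfolding orbit_prod_def
    by (rule prod.cong) (auto simp: ceval_geom_eq_of_nat omega_power_orbit_eq_1_iff)
  also have "\<dots> = 3 ^ 2"
    using gt1 by (simp add: orbit_prime_mult card_image inj_on_def)
  finally have "orbit_prod (3 * p) p (geom 3 3) = of_nat 3 ^ 2"
    by simp
  moreover have "orbit_prod (3 * p) d (geom 3 3) = 1" if "d \<in> {3, 1}" for d
  proof -
    have d: "\<not> 3 * p dvd 3 * d"
      using that np gt1 by auto
    \<comment> \<open>The number of terms 3 is not prime to \<open>3 * p\<close>, but only its residue modulo \<open>p\<close> matters here.\<close>
    have "coprime (3 + p) (3 * p)"
      using cop
      by (metis coprime_iff_gcd_eq_1 coprime_mult_right_iff gcd.commute gcd_add1 gcd_add2)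
    then have "orbit_prod (3 * p) d (geom (3 + p) 3) = 1"
      using gt1 d by (intro orbit_prod_geom) auto
    moreover have "orbit_prod (3 * p) d (geom (3 + p) 3) = orbit_prod (3 * p) d (geom 3 3)"
      unfolding orbit_prod_def
    proof (rule prod.cong)
      fix l assume l: "l \<in> orbit (3 * p) d"
      define y where "y = (omega (3 * p) ^ l) ^ 3"
      have "y \<noteq> 1" "y ^ p = 1"
        using l d by (simp_all add: y_def omega_power_orbit_eq_1_iff flip: power_mult[of _ 3 p])
      then show "ceval (geom (3 + p) 3) (omega (3 * p) ^ l) = ceval (geom 3 3) (omega (3 * p) ^ l)"
        by (simp add: ceval_geom geometric_sum power_add flip: y_def)
    qed simp
    ultimately show ?thesis
      by simp
  qed
  moreover have "poly (geom 3 3) 1 = int 3 * 1"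
    by (simp add: geom_def poly_sum poly_monom)
  moreover have "\<not> int p dvd 1"
    using gt1 by simp
  ultimately show ?thesis
    using cube_mult_in_circulant_detsI[OF 3 p, of "geom 3 3" 1 m] \<open>p \<noteq> 3\<close> m by simp
qed

text \<open>The units below come from a search for products of the \<open>1 + x\<^sup>b + \<dots> + x\<^bsup>b(a-1)\<^esup>\<close> that are congruent to
  some \<open>k x\<^sup>j (1 - x)\<^sup>2\<close> modulo \<open>p\<close> and the \<open>q\<close>-th cyclotomic polynomial.\<close>

lemma cube_mult_in_circulant_dets_5_7:
  fixes m :: int
  assumes "gcd m 7 = 1"
  shows "5 ^ 3 * m \<in> circulant_dets 35"
proof -
  \<comment> \<open>Subtracting \<open>1 + x + ... + x^6\<close> from the left side leaves
    \<open>2 x^2 + x^3 + 2 x^4\<close>.\<close>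
  have "geom 2 2 ^ 2 * geom 3 1 =
      smult 2 (monom 1 2 * [:1, -1:] ^ 2) + smult 5 [:0, 0, 0, 1:] + geom 7 1 * 1"
    by (simp add: geom_def numeral_eq_Suc monom_Suc monom_0 one_pCons)
  moreover have "orbit_prod 35 5 (geom 2 2 ^ 2 * geom 3 1) = 1"
    by (simp add: orbit_prod_mult orbit_prod_power orbit_prod_geom coprime_iff_gcd_eq_1 gcd_non_0_nat)
  ultimately show ?thesis
    using assms cube_mult_in_circulant_dets_of_unit
      [of 5 7 2 "geom 2 2 ^ 2 * geom 3 1" 2 "[:0, 0, 0, 1:]" 1 m]
    by simp
qed

lemma cube_mult_in_circulant_dets_7_5:
  fixes m :: int
  assumes "gcd m 5 = 1"
  shows "7 ^ 3 * m \<in> circulant_dets 35"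
proof -
  \<comment> \<open>Modulo 7 the factor is 5, which is not prime to 35; its representative 12
    is.\<close>
  have "geom 2 1 ^ 3 = smult 12 (monom 1 3 * [:1, -1:] ^ 2) + smult 7 [:-5, -3, -3, -5:]
      + geom 5 1 * [:36, -12:]"
    by (simp add: geom_def numeral_eq_Suc monom_Suc monom_0 one_pCons)
  moreover have "orbit_prod 35 7 (geom 2 1 ^ 3) = 1"
    by (simp add: orbit_prod_power orbit_prod_geom)
  moreover have "coprime 12 (35 :: nat)"
    by (simp add: coprime_iff_gcd_eq_1 gcd_non_0_nat)
  ultimately show ?thesis
    using assms cube_mult_in_circulant_dets_of_unit
      [of 7 5 12 "geom 2 1 ^ 3" 3 "[:-5, -3, -3, -5:]" "[:36, -12:]" m]
    by simp
qed

lemma cube_mult_in_circulant_dets_5_11: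
  fixes m :: int
  assumes "gcd m 11 = 1"
  shows "5 ^ 3 * m \<in> circulant_dets 55"
proof -
  have "geom 2 2 ^ 3 * geom 2 3 ^ 3 =
      smult 4 (monom 1 1 * [:1, -1:] ^ 2) + smult 5 [:-1, -2, 1, -2, -1, 0, -1, 0, 0, -1:]
      + geom 11 1 * [:6, 0, 0, 3, -1, 1:]"
    by (simp add: geom_def numeral_eq_Suc monom_Suc monom_0 one_pCons)
  moreover have "orbit_prod 55 5 (geom 2 2 ^ 3 * geom 2 3 ^ 3) = 1"
    by (simp add: orbit_prod_mult orbit_prod_power orbit_prod_geom)
  moreover have "coprime 4 (55 :: nat)"
    by (simp add: coprime_iff_gcd_eq_1 gcd_non_0_nat)
  ultimately show ?thesis
    using assms cube_mult_in_circulant_dets_of_unit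
      [of 5 11 4 "geom 2 2 ^ 3 * geom 2 3 ^ 3" 1 "[:-1, -2, 1, -2, -1, 0, -1, 0, 0, -1:]"
        "[:6, 0, 0, 3, -1, 1:]" m]
    by simp
qed

lemma cube_mult_in_circulant_dets_11_5:
  fixes m :: int
  assumes "gcd m 5 = 1"
  shows "11 ^ 3 * m \<in> circulant_dets 55"
proof -
  \<comment> \<open>The binomial coefficients 1, 4, 6, 4, 1 minus all ones leave
    \<open>3 x + 5 x^2 + 3 x^3\<close>.\<close>
  have "geom 2 1 ^ 4 = smult 3 (monom 1 1 * [:1, -1:] ^ 2) + smult 11 [:0, 0, 1:] + geom 5 1 * 1"
    by (simp add: geom_def numeral_eq_Suc monom_Suc monom_0 one_pCons)
  moreover have "orbit_prod 55 11 (geom 2 1 ^ 4) = 1"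
    by (simp add: orbit_prod_power orbit_prod_geom)
  moreover have "coprime 3 (55 :: nat)"
    by (simp add: coprime_iff_gcd_eq_1 gcd_non_0_nat)
  ultimately show ?thesis
    using assms cube_mult_in_circulant_dets_of_unit
      [of 11 5 3 "geom 2 1 ^ 4" 1 "[:0, 0, 1:]" 1 m]
    by simp
qed

lemma prime_factors_of_prime_mult:
  fixes p q r s :: nat
  assumes "prime p" "prime q" "prime r" "prime s" and "p * q = r * s"
  shows "p = r \<and> q = s \<or> p = s \<and> q = r"
proof -
  have "p dvd r * s"
    using assms by (metis dvd_triv_left)
  then have "p = r \<or> p = s"
    using assms by (metis prime_dvd_mult_iff primes_dvd_imp_eq)
  then show ?thesis
    using assms by (auto simp: prime_gt_0_nat)
qed

theorem theorem2:
  fixes p q :: nat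
  assumes "prime p" and "prime q" and "odd p" and "odd q" and "p \<noteq> q"
    and "q = 3 \<or> p * q = 35 \<or> p * q = 55"
  shows "{int p ^ 3 * m | m :: int. gcd m (int q) = 1} \<union>
         {int q ^ 3 * m | m :: int. gcd m (int p) = 1} \<subseteq> circulant_dets (p * q)"
proof -
  \<comment> \<open>The inclusion is symmetric in \<open>p\<close> and \<open>q\<close>, but 35 and
    55 can each be factored in either order.\<close>
  consider "q = 3" | "p = 5" "q = 7" | "p = 7" "q = 5" | "p = 5" "q = 11" | "p = 11" "q = 5"
    using assms prime_factors_of_prime_mult[of p q 5 7] prime_factors_of_prime_mult[of p q 5 11]
    by auto
  then show ?thesis
  proof cases
    case 1
    then show ?thesis
      using assms cube_mult_in_circulant_dets_3[of p] cube_mult_in_circulant_dets_27[of p]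
      by (auto simp: mult.commute[of p 3])
  qed (use cube_mult_in_circulant_dets_5_7 cube_mult_in_circulant_dets_7_5
      cube_mult_in_circulant_dets_5_11 cube_mult_in_circulant_dets_11_5 in auto)
qed

end
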